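(* Let $r=r(n)\ge3$, $m=m(n)$ and $k=k(n)$ be integers with $m=o(r^{-3}n^{3/2})$ and $k=o\bigl(\frac{n^3}{r^6m^2}\bigr)$. Let $K=K(n)$ be a linear $r$-graph on $[n]$ with $k$ edges, and let $H$ be chosen uniformly at random from $\mathcal{L}_r(n,m)$. Then, as $n\to\infty$, \[ \mathbb{P}[K\subseteq H]=\frac{[m]_k}{N^k}\exp\Bigl[\frac{[r]_2^2k^2}{4n^2}+O\Bigl(\frac{r^4k}{n^2}+\min\Bigl\{\frac{r^6m^2k}{n^3},\frac{r^5mk}{n^2}\Bigr\}\Bigr)\Bigr]. \]
   Context: An $r$-graph on $[n]$ is a set of $r$-subsets of $[n]$ (edges); it is linear if any two distinct edges share at most one vertex. $\mathcal{L}_r(n,m)$ is the set of linear $r$-graphs on $[n]$ with exactly $m$ edges. $K\subseteq H$ means every edge of $K$ is an edge of $H$. $N=\binom nr$, $[x]_t=x(x-1)\cdots(x-t+1)$. *)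

theory Defs
  imports "HOL-Analysis.Analysis" "HOL-Library.Landau_Symbols"
begin

definition rgraph_on :: "nat \<Rightarrow> nat \<Rightarrow> nat set set \<Rightarrow> bool" where
  "rgraph_on r n H \<longleftrightarrow> (\<forall>e\<in>H. e \<subseteq> {1..n} \<and> card e = r)"

definition linear_hg :: "nat set set \<Rightarrow> bool" where
  "linear_hg H \<longleftrightarrow> (\<forall>e\<in>H. \<forall>f\<in>H. e \<noteq> f \<longrightarrow> card (e \<inter> f) \<le> 1)"

definition Lin :: "nat \<Rightarrow> nat \<Rightarrow> nat \<Rightarrow> nat set set set" where
  "Lin r n m = {H. rgraph_on r n H \<and> linear_hg H \<and> card H = m}"

definition prob_contained :: "nat \<Rightarrow> nat \<Rightarrow> nat \<Rightarrow> nat set set \<Rightarrow> real" where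
  "prob_contained r n m K = real (card {H \<in> Lin r n m. K \<subseteq> H}) / real (card (Lin r n m))"

definition ffall :: "real \<Rightarrow> nat \<Rightarrow> real" where
  "ffall x t = (\<Prod>i<t. x - real i)"

end

theory Submission
  imports Defs
begin

text \<open>
  Write \<open>A M F\<close> for the number of linear \<open>r\<close>-graphs with \<open>M\<close> edges that contain \<open>F\<close>, where \<open>F\<close> has
  \<open>f\<close> edges.  Double counting gives \<open>(m - f) * A m F\<close> as the sum of \<open>A m (F + g)\<close> over the edges \<open>g\<close>
  that can be added to \<open>F\<close>, and \<open>A m (F + g) = A (m - 1) F * (1 - b g)\<close>, where \<open>b g\<close> is the probability
  that a random \<open>(m - 1)\<close>-edge extension of \<open>F\<close> has an edge meeting \<open>g\<close> in at least two vertices.  A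
  first-moment bound yields \<open>A M (F + h) = (M - f) / N * A M F\<close> up to a factor \<open>1 + O(r^4 m / n^2)\<close>;
  inserting this into the first two Bonferroni inequalities shows that \<open>b g\<close> agrees with a quantity
  independent of \<open>g\<close> up to \<open>O(min (r^6 m^2 / n^3) (r^4 m / n^2))\<close>.  So the terms of the sum are almost equal
  and \<open>A m (F + g) / A m F\<close> is nearly \<open>(m - f)\<close> divided by the number of addable edges, which is
  \<open>N * (1 - f * [r]_2^2 / (2 n^2))\<close> up to the same error.  Multiplying over the edges of \<open>K\<close> gives the
  theorem.
\<close>

section \<open>A Bonferroni lower bound for unions\<close>

text \<open>Inserting \<open>x\<close> costs at most the overlaps of \<open>A x\<close> with the
  sets already present. The double sum runs over ordered pairs, so it is twice the usual Bonferroni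
  correction; pairs only enter error terms later, so the loss is harmless.\<close>

lemma bonferroni_card_UN:
  assumes "finite I" "\<And>i. i \<in> I \<Longrightarrow> finite (A i)"
  shows "(\<Sum>i\<in>I. card (A i)) \<le> card (\<Union>i\<in>I. A i) + (\<Sum>i\<in>I. \<Sum>j\<in>I - {i}. card (A i \<inter> A j))"
  using assms
proof (induction I rule: finite_induct)
  case empty
  then show ?case by simp
next
  case (insert x I)
  let ?U = "\<Union>i\<in>I. A i"
  have fin: "finite (A x)" "finite ?U" using insert by auto
  have "card (A x \<inter> ?U) \<le> (\<Sum>j\<in>I. card (A x \<inter> A j))"
    using card_UN_le[OF insert(1), of "\<lambda>j. A x \<inter> A j"] by (simp only: Int_UN_distrib)
  moreover have "card (A x) + card ?U = card (A x \<union> ?U) + card (A x \<inter> ?U)"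
    using fin by (rule card_Un_Int)
  moreover have "(\<Sum>i\<in>I. \<Sum>j\<in>I - {i}. card (A i \<inter> A j))
      \<le> (\<Sum>i\<in>I. \<Sum>j\<in>insert x I - {i}. card (A i \<inter> A j))"
    using insert(1) by (intro sum_mono sum_mono2) auto
  moreover have "insert x I - {x} = I" using insert(2) by auto
  ultimately show ?case using insert by simp
qed

section \<open>Edges, clashes, addable edges and extensions\<close>

definition edges :: "nat \<Rightarrow> nat \<Rightarrow> nat set set" where
  "edges r n = {e. e \<subseteq> {1..n} \<and> card e = r}"

text \<open>For \<open>2 \<le> r\<close> an edge clashes with itself, so an \<open>H\<close>
  disjoint from \<open>clash r n g\<close> never contains the edge \<open>g\<close>.\<close>

definition clash :: "nat \<Rightarrow> nat \<Rightarrow> nat set \<Rightarrow> nat set set" where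
  "clash r n e = {h \<in> edges r n. 2 \<le> card (h \<inter> e)}"

text \<open>For \<open>2 \<le> r\<close> the intersection bound already excludes the members of
  \<open>F\<close>, since an edge meets itself in \<open>r\<close> vertices.\<close>

definition addable :: "nat \<Rightarrow> nat \<Rightarrow> nat set set \<Rightarrow> nat set set" where
  "addable r n F = {g \<in> edges r n. \<forall>h\<in>F. card (g \<inter> h) \<le> 1}"

definition extensions :: "nat \<Rightarrow> nat \<Rightarrow> nat \<Rightarrow> nat set set \<Rightarrow> nat set set set" where
  "extensions r n m F = {H \<in> Lin r n m. F \<subseteq> H}"

lemma finite_edges: "finite (edges r n)"
  unfolding edges_def by (rule finite_subset[of _ "Pow {1..n}"]) auto

lemma finite_edge: "e \<in> edges r n \<Longrightarrow> finite e"
  unfolding edges_def using finite_subset by blast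

lemma card_edges: "card (edges r n) = n choose r"
  unfolding edges_def using n_subsets[of "{1..n}" r] by simp

lemma finite_clash: "finite (clash r n e)"
  unfolding clash_def using finite_edges by simp

lemma finite_addable: "finite (addable r n F)"
  unfolding addable_def using finite_edges by simp

lemma Lin_iff: "H \<in> Lin r n m \<longleftrightarrow> H \<subseteq> edges r n \<and> linear_hg H \<and> card H = m"
  unfolding Lin_def rgraph_on_def edges_def by auto

lemma finite_Lin: "finite (Lin r n m)"
  by (rule finite_subset[of _ "Pow (edges r n)"]) (auto simp: Lin_iff finite_edges)

lemma finite_extensions: "finite (extensions r n m F)"
  unfolding extensions_def using finite_Lin by simp

lemma LinD:
  assumes "H \<in> Lin r n m"
  shows "H \<subseteq> edges r n" "linear_hg H" "card H = m" "finite H"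
  using assms finite_subset[OF _ finite_edges] by (auto simp: Lin_iff)

section \<open>Counting edges through a set and edges meeting an edge\<close>

lemma card_edges_superset:
  assumes S: "S \<subseteq> {1..n}" "card S \<le> r"
  shows "card {g \<in> edges r n. S \<subseteq> g} = (n - card S) choose (r - card S)"
proof -
  have finS: "finite S" using S finite_subset by blast
  have "bij_betw (\<lambda>g. g - S) {g \<in> edges r n. S \<subseteq> g} {T. T \<subseteq> {1..n} - S \<and> card T = r - card S}"
  proof (rule bij_betw_byWitness[where f' = "\<lambda>T. T \<union> S"])
    show "(\<lambda>T. T \<union> S) ` {T. T \<subseteq> {1..n} - S \<and> card T = r - card S} \<subseteq> {g \<in> edges r n. S \<subseteq> g}"
    proof clarify
      fix T assume T: "T \<subseteq> {1..n} - S" "card T = r - card S"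
      have "finite T" using T(1) finite_subset by blast
      then have "card (T \<union> S) = r"
        using T S finS by (subst card_Un_disjoint) auto
      then show "T \<union> S \<in> edges r n \<and> S \<subseteq> T \<union> S"
        using T S by (auto simp: edges_def)
    qed
  qed (use finS in \<open>auto simp: edges_def card_Diff_subset\<close>)
  then have "card {g \<in> edges r n. S \<subseteq> g} = card {T. T \<subseteq> {1..n} - S \<and> card T = r - card S}"
    by (rule bij_betw_same_card)
  also have "\<dots> = card ({1..n} - S) choose (r - card S)"
    by (rule n_subsets) simp
  also have "card ({1..n} - S) = n - card S"
    using S finS by (simp add: card_Diff_subset)
  finally show ?thesis .
qed

text \<open>Double counting of pairs of an edge \<open>g\<close> and a \<open>t\<close>-subset
  \<open>S\<close> of \<open>g \<inter> e\<close>. These are binomial moments of the intersection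
  size; the cases \<open>t = 2\<close> and \<open>t = 3\<close> determine the size of a clash set up
  to lower order.\<close>

lemma sum_choose_card_Int:
  assumes e: "e \<in> edges r n" and t: "t \<le> r"
  shows "(\<Sum>g\<in>edges r n. card (g \<inter> e) choose t) = (r choose t) * ((n - t) choose (r - t))"
proof -
  let ?T = "{S. S \<subseteq> e \<and> card S = t}"
  have fe: "finite e" using e by (rule finite_edge)
  have "(\<Sum>g\<in>edges r n. card {S \<in> ?T. S \<subseteq> g}) = (\<Sum>S\<in>?T. (n - t) choose (r - t))"
  proof (rule sum_multicount_gen)
    show "finite ?T" using fe by simp
    show "\<forall>S\<in>?T. card {g \<in> edges r n. S \<subseteq> g} = (n - t) choose (r - t)"
      using card_edges_superset e t by (auto simp: edges_def)
  qed (rule finite_edges)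
  moreover have "card {S \<in> ?T. S \<subseteq> g} = card (g \<inter> e) choose t" for g
  proof -
    have "{S \<in> ?T. S \<subseteq> g} = {S. S \<subseteq> g \<inter> e \<and> card S = t}" by auto
    then show ?thesis using n_subsets[of "g \<inter> e" t] fe by simp
  qed
  moreover have "card ?T = r choose t"
    using n_subsets[OF fe, of t] e by (simp add: edges_def)
  ultimately show ?thesis by simp
qed

text \<open>This bounds how far the second binomial moment overcounts the clash indicator. From
  \<open>j\<close> to \<open>j + 1\<close> the left side grows by \<open>j\<close> and the last term
  by \<open>j * (j - 1)\<close>, which suffices once \<open>2 \<le> j\<close>; the step from 1 to 2
  is paid by the indicator.\<close>

lemma choose_two_le: "j choose 2 \<le> (if 2 \<le> j then 1 else 0) + 2 * (j choose 3)"
proof (induction j)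
  case (Suc j)
  have "Suc j choose 2 = (j choose 2) + j" by (simp add: numeral_2_eq_2)
  moreover have "Suc j choose 3 = (j choose 3) + (j choose 2)" by (simp add: numeral_2_eq_2 numeral_3_eq_3)
  moreover have "j \<le> 2 * (j choose 2)" if "2 \<le> j"
    using that by (simp add: choose_two)
  moreover have "j choose 2 = 0" if "j < 2" using that by simp
  ultimately show ?case using Suc by (auto split: if_splits)
qed (simp add: binomial_eq_0)

section \<open>Double counting of extensions by one edge\<close>

lemma addable_eq: "addable r n F = edges r n - (\<Union>h\<in>F. clash r n h)"
  by (auto simp: addable_def clash_def)

lemma addable_notin:
  assumes "2 \<le> r" "g \<in> addable r n F" shows "g \<notin> F"
  using assms by (auto simp: addable_def edges_def dest!: bspec)

lemma Lin_insert:
  assumes r: "2 \<le> r" and F: "F \<in> Lin r n f" and g: "g \<in> addable r n F"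
  shows "insert g F \<in> Lin r n (Suc f)"
proof -
  have "g \<notin> F" using addable_notin r g by blast
  moreover have "linear_hg (insert g F)"
    using LinD(2)[OF F] g by (auto simp: linear_hg_def addable_def Int_commute)
  ultimately show ?thesis using LinD[OF F] g by (auto simp: Lin_iff addable_def)
qed

lemma extensions_empty_if_card_gt:
  assumes "finite F" "M < card F" shows "extensions r n M F = {}"
proof -
  have False if "H \<in> Lin r n M" "F \<subseteq> H" for H
    using card_mono[OF LinD(4)[OF that(1)] that(2)] LinD(3)[OF that(1)] assms by simp
  then show ?thesis by (auto simp: extensions_def)
qed

lemma extensions_self:
  assumes F: "F \<in> Lin r n f" shows "extensions r n f F = {F}"
proof -
  have "H = F" if "H \<in> Lin r n f" "F \<subseteq> H" for H
    using card_subset_eq[OF LinD(4)[OF that(1)] that(2)] LinD(3)[OF that(1)] LinD(3)[OF F] by simp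
  then show ?thesis using F by (auto simp: extensions_def)
qed

lemma extensions_insert_eq: "extensions r n M (insert g F) = {H \<in> extensions r n M F. g \<in> H}"
  by (auto simp: extensions_def)

text \<open>By linearity each edge of \<open>H - F\<close> is compatible with \<open>F\<close>.
  Hence every extension with \<open>M\<close> edges contains the same number of addable edges, which
  makes the double count below exact.\<close>

lemma extensions_Int_addable:
  assumes r: "2 \<le> r" and H: "H \<in> extensions r n M F"
  shows "{g \<in> addable r n F. g \<in> H} = H - F"
proof -
  have HL: "H \<in> Lin r n M" "F \<subseteq> H" using H by (auto simp: extensions_def)
  have "g \<in> addable r n F" if "g \<in> H - F" for g
  proof -
    have "card (g \<inter> h) \<le> 1" if h: "h \<in> F" for h
    proof -
      have "g \<in> H" "h \<in> H" "g \<noteq> h" using h HL(2) \<open>g \<in> H - F\<close> by auto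
      then show ?thesis using LinD(2)[OF HL(1)] by (simp add: linear_hg_def)
    qed
    then show ?thesis using LinD(1)[OF HL(1)] that by (auto simp: addable_def)
  qed
  then show ?thesis using addable_notin[OF r] by blast
qed

lemma sum_card_extensions_insert:
  assumes r: "2 \<le> r" and F: "F \<in> Lin r n f"
  shows "(\<Sum>g\<in>addable r n F. card (extensions r n M (insert g F))) = (M - f) * card (extensions r n M F)"
proof -
  have "(\<Sum>g\<in>addable r n F. card {H \<in> extensions r n M F. g \<in> H}) = (\<Sum>H\<in>extensions r n M F. M - f)"
  proof (rule sum_multicount_gen)
    show "\<forall>H\<in>extensions r n M F. card {g \<in> addable r n F. g \<in> H} = M - f"
    proof
      fix H assume H: "H \<in> extensions r n M F"
      then have "H \<in> Lin r n M" "F \<subseteq> H" by (auto simp: extensions_def)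
      then have "card (H - F) = M - f"
        using LinD[OF F] LinD(3)[of H r n M] by (simp add: card_Diff_subset)
      then show "card {g \<in> addable r n F. g \<in> H} = M - f" using extensions_Int_addable[OF r H] by simp
    qed
  qed (auto simp: finite_addable finite_extensions)
  then show ?thesis by (simp add: extensions_insert_eq)
qed

text \<open>Deleting \<open>g\<close> is a bijection with inverse \<open>insert g\<close>: a linear
  \<open>H\<close> containing \<open>g\<close> has no other edge clashing with \<open>g\<close>, and
  conversely \<open>g\<close> can be added to any \<open>H\<close> that avoids its clashes. Since
  \<open>g \<notin> F\<close>, the deletion keeps \<open>F\<close>.\<close>

lemma card_extensions_Suc_insert:
  assumes r: "2 \<le> r" and F: "F \<in> Lin r n f" and g: "g \<in> addable r n F"
  shows "card (extensions r n (Suc M) (insert g F)) = card {H \<in> extensions r n M F. H \<inter> clash r n g = {}}"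
proof -
  have gE: "g \<in> edges r n" and gF: "g \<notin> F" using g addable_notin[OF r g] by (auto simp: addable_def)
  have gg: "g \<in> clash r n g" using gE r by (simp add: clash_def edges_def)
  have "bij_betw (\<lambda>H. H - {g}) (extensions r n (Suc M) (insert g F)) {H \<in> extensions r n M F. H \<inter> clash r n g = {}}"
  proof (rule bij_betw_byWitness[where f' = "insert g"])
    show "\<forall>H\<in>extensions r n (Suc M) (insert g F). insert g (H - {g}) = H"
      by (auto simp: extensions_def)
    show "\<forall>H\<in>{H \<in> extensions r n M F. H \<inter> clash r n g = {}}. insert g H - {g} = H"
      using gg by auto
    show "(\<lambda>H. H - {g}) ` extensions r n (Suc M) (insert g F) \<subseteq> {H \<in> extensions r n M F. H \<inter> clash r n g = {}}"
    proof clarify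
      fix H assume "H \<in> extensions r n (Suc M) (insert g F)"
      then have H: "H \<in> Lin r n (Suc M)" "g \<in> H" "F \<subseteq> H" by (auto simp: extensions_def)
      have "H - {g} \<in> Lin r n M"
        using LinD[OF H(1)] H(2) by (auto simp: Lin_iff linear_hg_def)
      moreover have "(H - {g}) \<inter> clash r n g = {}"
        using LinD(2)[OF H(1)] H(2) by (force simp: linear_hg_def clash_def)
      ultimately show "H - {g} \<in> extensions r n M F \<and> (H - {g}) \<inter> clash r n g = {}"
        using H gF by (auto simp: extensions_def)
    qed
    show "insert g ` {H \<in> extensions r n M F. H \<inter> clash r n g = {}} \<subseteq> extensions r n (Suc M) (insert g F)"
    proof clarify
      fix H assume H: "H \<in> extensions r n M F" "H \<inter> clash r n g = {}"
      then have HL: "H \<in> Lin r n M" "F \<subseteq> H" by (auto simp: extensions_def)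
      have "g \<in> addable r n H"
        using H(2) gE LinD(1)[OF HL(1)] by (fastforce simp: addable_def clash_def Int_commute)
      then show "insert g H \<in> extensions r n (Suc M) (insert g F)"
        using Lin_insert[OF r HL(1)] HL(2) by (auto simp: extensions_def)
    qed
  qed
  then show ?thesis by (rule bij_betw_same_card)
qed

section \<open>Sizes of clash sets and of their intersections\<close>

lemma choose_two_bound: "2 * real (j choose 2) \<le> real j ^ 2"
  using of_nat_mono[where 'a = real, OF binomial_fact_pow[of j 2]] by simp

lemma choose_three_bound: "6 * real (j choose 3) \<le> real j ^ 3"
  using of_nat_mono[where 'a = real, OF binomial_fact_pow[of j 3]] by (simp add: fact_numeral)

locale sparse_range =
  fixes n r :: nat
  assumes r3: "3 \<le> r" and rn: "r^2 \<le> n"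
begin

text \<open>The total number of possible edges; all counts below are measured as fractions of
  it.\<close>

definition N :: real where "N = real (n choose r)"

text \<open>This is \<open>(r choose 2)^2 / (n choose 2)\<close>, the mean of
  \<open>card (g \<inter> e) choose 2\<close> over all edges \<open>g\<close> for a fixed edge
  \<open>e\<close>. To first order it is the probability that a random edge clashes with
  \<open>e\<close>.\<close>

definition \<delta> :: real where
  "\<delta> = (real r * (real r - 1))\<^sup>2 / (2 * real n * (real n - 1))"

text \<open>The order of the second-order effects: edges meeting \<open>e\<close> in three vertices,
  and edges clashing with two compatible edges. With \<open>choose_triple\<close> these need the
  constants 3/2 and 9/4, so 3 covers both.\<close>

definition \<rho> :: real where
  "\<rho> = 3 * real r ^ 6 / real n ^ 3"

lemma r_le_n: "r \<le> n"
  using rn by (simp add: power2_nat_le_imp_le)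

lemma n9: "9 \<le> n"
  using rn r3 power_mono[of 3 r 2] by simp

lemma N_pos: "0 < N"
  unfolding N_def using r_le_n by simp

lemma rho_nonneg: "0 \<le> \<rho>" unfolding \<rho>_def by simp

lemma delta_nonneg: "0 \<le> \<delta>" unfolding \<delta>_def using n9 by simp

text \<open>The factor \<open>n - 1\<close> in the denominator becomes \<open>n\<close> at the price
  of replacing \<open>(r - 1)^2\<close> by \<open>r^2\<close>; the difference to control is
  \<open>2 * r * n - n - r^2\<close>, and \<open>r^2 \<le> n\<close>.\<close>

lemma delta_le: "\<delta> \<le> real r ^ 4 / (2 * real n ^ 2)"
proof -
  have rn': "real r \<le> real n" "real r \<ge> 3" "real n \<ge> 9" using r_le_n r3 n9 by simp_all
  have "(real r - 1) ^ 2 * real n \<le> real r ^ 2 * (real n - 1)"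
  proof -
    have "real r ^ 2 \<le> real n" using rn by (metis of_nat_le_iff of_nat_power)
    have "real r ^ 2 * (real n - 1) - (real r - 1) ^ 2 * real n = 2 * real r * real n - real n - real r ^ 2"
      by (simp add: algebra_simps power2_eq_square)
    moreover have "6 * real n \<le> 2 * real r * real n" using rn' by (intro mult_right_mono) auto
    ultimately show ?thesis using \<open>real r ^ 2 \<le> real n\<close> rn' by linarith
  qed
  then have "(real r - 1) ^ 2 / (real n - 1) \<le> real r ^ 2 / real n"
    using rn' by (simp add: field_simps)
  then have "(real r ^ 2 / (2 * real n)) * ((real r - 1) ^ 2 / (real n - 1)) \<le> (real r ^ 2 / (2 * real n)) * (real r ^ 2 / real n)"
    by (intro mult_left_mono) auto
  then show ?thesis
    unfolding \<delta>_def by (simp add: power_mult_distrib power2_eq_square power4_eq_xxxx mult_ac)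
qed

text \<open>Writing \<open>r^8\<close> as \<open>r^6 * r^2\<close> and using
  \<open>r^2 \<le> n\<close> saves one power of \<open>n\<close>. This lets quadratic terms in
  \<delta> be absorbed into \<rho>.\<close>

lemma delta_sq_le: "\<delta>\<^sup>2 \<le> \<rho>"
proof -
  have rr: "real r ^ 2 \<le> real n" using rn by (metis of_nat_le_iff of_nat_power)
  have n0: "real n > 0" using n9 by simp
  have "\<delta>\<^sup>2 \<le> (real r ^ 4 / (2 * real n ^ 2))\<^sup>2"
    using delta_le delta_nonneg by (intro power_mono) auto
  also have "\<dots> = real r ^ 6 / (4 * real n ^ 4) * real r ^ 2"
    by (simp add: power_divide power_mult_distrib flip: power_mult power_add)
  also have "\<dots> \<le> real r ^ 6 / (4 * real n ^ 4) * real n"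
    using rr by (intro mult_left_mono) auto
  also have "\<dots> = \<rho> / 12" unfolding \<rho>_def using n0 by (simp add: field_simps power4_eq_xxxx power3_eq_cube)
  also have "\<dots> \<le> \<rho>" using rho_nonneg by simp
  finally show ?thesis .
qed

lemma choose_pair: "real (r choose 2) * real ((n - 2) choose (r - 2)) = N * \<delta>"
proof -
  have c2: "real (j choose 2) = real j * (real j - 1) / 2" if "1 \<le> j" for j
    using that by (simp add: choose_two real_of_nat_div of_nat_diff)
  have "(n choose r) * (r choose 2) = (n choose 2) * ((n - 2) choose (r - 2))"
    using r3 r_le_n by (intro choose_mult) auto
  then have "N * real (r choose 2) = real (n choose 2) * real ((n - 2) choose (r - 2))"
    unfolding N_def by (metis of_nat_mult)
  then have "real ((n - 2) choose (r - 2)) = N * real (r choose 2) / real (n choose 2)"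
    using n9 by (simp add: field_simps)
  then have "real (r choose 2) * real ((n - 2) choose (r - 2))
      = N * (real (r choose 2) ^ 2 / real (n choose 2))" by (simp add: power2_eq_square)
  also have "real (r choose 2) ^ 2 / real (n choose 2) = \<delta>"
  proof -
    have "real (r choose 2) = real r * (real r - 1) / 2" using r3 by (intro c2) simp
    moreover have "real (n choose 2) = real n * (real n - 1) / 2" using n9 by (intro c2) simp
    ultimately show ?thesis unfolding \<delta>_def by (simp only:) (simp add: power_divide)
  qed
  finally show ?thesis .
qed

text \<open>The crude bound \<open>(n choose 3) \<ge> (n / 3)^3\<close> together with
  \<open>(r choose 3) \<le> r^3 / 6\<close> gives the factor 27/6 = 9/2.\<close>

lemma choose_triple: "real ((n - 3) choose (r - 3)) \<le> N * (9/2 * real r ^ 3 / real n ^ 3)"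
proof -
  have "(n choose r) * (r choose 3) = (n choose 3) * ((n - 3) choose (r - 3))"
    using r3 r_le_n by (intro choose_mult) auto
  then have eq: "N * real (r choose 3) = real (n choose 3) * real ((n - 3) choose (r - 3))"
    unfolding N_def by (metis of_nat_mult)
  have lo: "(real n / 3) ^ 3 \<le> real (n choose 3)"
    using binomial_ge_n_over_k_pow_k[of 3 n, where 'a = real] n9 by simp
  have up: "6 * real (r choose 3) \<le> real r ^ 3"
    by (rule choose_three_bound)
  have "(real n / 3) ^ 3 * real ((n - 3) choose (r - 3)) \<le> N * (real r ^ 3 / 6)"
  proof -
    have "(real n / 3) ^ 3 * real ((n - 3) choose (r - 3)) \<le> N * real (r choose 3)"
      unfolding eq by (intro mult_right_mono[OF lo]) simp
    also have "\<dots> \<le> N * (real r ^ 3 / 6)" using up N_pos by (intro mult_left_mono) auto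
    finally show ?thesis .
  qed
  then show ?thesis using n9 by (simp add: field_simps power3_eq_cube)
qed

text \<open>Each clashing edge contributes at least 1 to the second binomial moment.\<close>

lemma card_clash_le:
  assumes "e \<in> edges r n" shows "real (card (clash r n e)) \<le> N * \<delta>"
proof -
  have "card (clash r n e) = (\<Sum>g\<in>clash r n e. 1)" by simp
  also have "\<dots> \<le> (\<Sum>g\<in>clash r n e. card (g \<inter> e) choose 2)"
    by (intro sum_mono) (simp add: clash_def Suc_le_eq)
  also have "\<dots> \<le> (\<Sum>g\<in>edges r n. card (g \<inter> e) choose 2)"
    by (intro sum_mono2) (auto simp: clash_def finite_edges)
  also have "\<dots> = (r choose 2) * ((n - 2) choose (r - 2))"
    using assms r3 by (intro sum_choose_card_Int) auto
  finally show ?thesis using choose_pair by (metis of_nat_le_iff of_nat_mult)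
qed

text \<open>The overcount in the second moment is at most twice the third moment, which has order
  \<open>N * \<rho>\<close>.\<close>

lemma card_clash_ge:
  assumes e: "e \<in> edges r n" shows "N * (\<delta> - \<rho>) \<le> real (card (clash r n e))"
proof -
  have "(r choose 2) * ((n - 2) choose (r - 2)) = (\<Sum>g\<in>edges r n. card (g \<inter> e) choose 2)"
    using e r3 by (intro sum_choose_card_Int[symmetric]) auto
  also have "\<dots> \<le> (\<Sum>g\<in>edges r n. (if 2 \<le> card (g \<inter> e) then 1 else 0) + 2 * (card (g \<inter> e) choose 3))"
    by (intro sum_mono choose_two_le)
  also have "\<dots> = card (clash r n e) + 2 * ((r choose 3) * ((n - 3) choose (r - 3)))"
    using sum_choose_card_Int[OF e, of 3] r3
    by (simp add: sum.distrib clash_def finite_edges flip: sum_distrib_left sum.inter_filter)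
  finally have "real (r choose 2) * real ((n - 2) choose (r - 2))
      \<le> real (card (clash r n e)) + 2 * (real (r choose 3) * real ((n - 3) choose (r - 3)))"
    by (metis of_nat_le_iff of_nat_mult of_nat_add of_nat_numeral)
  moreover have "2 * (real (r choose 3) * real ((n - 3) choose (r - 3))) \<le> N * \<rho>"
  proof -
    have up: "6 * real (r choose 3) \<le> real r ^ 3"
      by (rule choose_three_bound)
    have "real (r choose 3) * real ((n - 3) choose (r - 3)) \<le> (real r ^ 3 / 6) * (N * (9/2 * real r ^ 3 / real n ^ 3))"
      using up choose_triple by (intro mult_mono) auto
    also have "\<dots> = N * \<rho> / 4" unfolding \<rho>_def by (simp flip: power_add)
    finally show ?thesis using N_pos rho_nonneg mult_nonneg_nonneg[of N \<rho>] by linarith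
  qed
  ultimately show ?thesis using choose_pair by (simp add: algebra_simps)
qed

text \<open>A common clash \<open>g\<close> contains a pair \<open>S\<close> from \<open>e\<close>.
  As \<open>e \<inter> h\<close> has at most one vertex while \<open>g \<inter> h\<close> has two,
  \<open>g\<close> also contains some \<open>z\<close> in \<open>h - e\<close>. So \<open>g\<close>
  contains one of at most \<open>(r choose 2) * r\<close> triples.\<close>

lemma card_clash_Int_le:
  assumes e: "e \<in> edges r n" and h: "h \<in> edges r n" and eh: "card (e \<inter> h) \<le> 1"
  shows "real (card (clash r n e \<inter> clash r n h)) \<le> N * \<rho>"
proof -
  let ?P = "{S. S \<subseteq> e \<and> card S = 2} \<times> (h - e)"
  have fin: "finite e" "finite h" using e h finite_edge by auto
  have finP: "finite ?P" using fin by simp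
  have sub: "clash r n e \<inter> clash r n h \<subseteq> (\<Union>(S, z)\<in>?P. {g \<in> edges r n. insert z S \<subseteq> g})"
  proof
    fix g assume g: "g \<in> clash r n e \<inter> clash r n h"
    then have "2 \<le> card (g \<inter> e)" "2 \<le> card (g \<inter> h)" by (auto simp: clash_def)
    then obtain S where S: "S \<subseteq> g \<inter> e" "card S = 2" by (meson obtain_subset_with_card_n)
    have "\<not> g \<inter> h \<subseteq> e \<inter> h"
      using card_mono[of "e \<inter> h" "g \<inter> h"] fin \<open>2 \<le> card (g \<inter> h)\<close> eh by force
    then obtain z where "z \<in> g" "z \<in> h - e" by blast
    then show "g \<in> (\<Union>(S, z)\<in>?P. {g \<in> edges r n. insert z S \<subseteq> g})"
      using S g by (auto simp: clash_def)
  qed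
  have each: "card {g \<in> edges r n. insert z S \<subseteq> g} = (n - 3) choose (r - 3)"
    if "(S, z) \<in> ?P" for S z
  proof -
    have "finite S" using that fin finite_subset by blast
    moreover have "z \<notin> S" using that by auto
    ultimately have "card (insert z S) = 3" using that by simp
    moreover have "insert z S \<subseteq> {1..n}" using that e h by (auto simp: edges_def)
    ultimately show ?thesis using card_edges_superset[of "insert z S" n r] r3 by simp
  qed
  have "card (clash r n e \<inter> clash r n h) \<le> card (\<Union>(S, z)\<in>?P. {g \<in> edges r n. insert z S \<subseteq> g})"
    using sub finP finite_edges by (intro card_mono) auto
  also have "\<dots> \<le> (\<Sum>p\<in>?P. card (case p of (S, z) \<Rightarrow> {g \<in> edges r n. insert z S \<subseteq> g}))"
    using finP by (rule card_UN_le)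
  also have "\<dots> = (\<Sum>p\<in>?P. (n - 3) choose (r - 3))"
    using each by (intro sum.cong) auto
  also have "\<dots> = card ?P * ((n - 3) choose (r - 3))" by simp
  also have "card ?P \<le> (r choose 2) * r"
  proof -
    have "card (h - e) \<le> r" using h fin card_mono[of h "h - e"] by (auto simp: edges_def)
    then show ?thesis using n_subsets[OF fin(1), of 2] e by (simp add: card_cartesian_product edges_def)
  qed
  finally have "card (clash r n e \<inter> clash r n h) \<le> (r choose 2) * r * ((n - 3) choose (r - 3))"
    by simp
  then have "real (card (clash r n e \<inter> clash r n h)) \<le> real ((r choose 2) * r * ((n - 3) choose (r - 3)))"
    by (rule of_nat_mono)
  also have "\<dots> \<le> (real r ^ 2 / 2 * real r) * (N * (9/2 * real r ^ 3 / real n ^ 3))"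
  proof -
    have "2 * real (r choose 2) \<le> real r ^ 2"
      by (rule choose_two_bound)
    then show ?thesis unfolding of_nat_mult using choose_triple by (intro mult_mono) auto
  qed
  also have "\<dots> = 3/4 * (N * \<rho>)" unfolding \<rho>_def by (simp add: power2_eq_square eval_nat_numeral)
  also have "\<dots> \<le> N * \<rho>" using N_pos rho_nonneg by simp
  finally show ?thesis .
qed

section \<open>First estimates for the number of extensions\<close>

abbreviation A :: "nat \<Rightarrow> nat set set \<Rightarrow> real" where
  "A M F \<equiv> real (card (extensions r n M F))"

text \<open>Divided by \<open>A M F\<close>, this is the probability that \<open>g\<close> cannot be
  added to a random extension of \<open>F\<close> with \<open>M\<close> edges.\<close>

abbreviation bad :: "nat \<Rightarrow> nat set set \<Rightarrow> nat set \<Rightarrow> real" where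
  "bad M F g \<equiv> real (card {H \<in> extensions r n M F. H \<inter> clash r n g \<noteq> {}})"

lemma r2: "2 \<le> r" using r3 by simp

lemma A_insert_eq:
  assumes "F \<in> Lin r n f" "g \<in> addable r n F"
  shows "A (Suc M) (insert g F) = A M F - bad M F g"
proof -
  let ?G = "{H \<in> extensions r n M F. H \<inter> clash r n g = {}}" and ?B = "{H \<in> extensions r n M F. H \<inter> clash r n g \<noteq> {}}"
  have "card (?G \<union> ?B) = card ?G + card ?B"
    by (rule card_Un_disjoint) (auto simp: finite_extensions)
  moreover have "?G \<union> ?B = extensions r n M F" by blast
  ultimately have "card (extensions r n M F) = card ?G + card ?B" by simp
  then show ?thesis using card_extensions_Suc_insert[OF r2 assms, of M] by simp
qed

lemma A_insert_le:
  assumes "F \<in> Lin r n f" "g \<in> addable r n F"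
  shows "A (Suc M) (insert g F) \<le> A M F"
  using A_insert_eq[OF assms] by simp

lemma sum_A_insert:
  assumes "F \<in> Lin r n f"
  shows "(\<Sum>g\<in>addable r n F. A M (insert g F)) = real (M - f) * A M F"
  using arg_cong[OF sum_card_extensions_insert[OF r2 assms, of M], of real] by simp

lemma card_addable_le: "real (card (addable r n F)) \<le> N"
  unfolding N_def card_edges[symmetric] addable_def
  by (intro of_nat_mono card_mono finite_edges) auto

lemma card_addable_ge:
  assumes "F \<in> Lin r n f"
  shows "N * (1 - real f * \<delta>) \<le> real (card (addable r n F))"
proof -
  have "real (card (\<Union>h\<in>F. clash r n h)) \<le> (\<Sum>h\<in>F. real (card (clash r n h)))"
    using of_nat_mono[OF card_UN_le[OF LinD(4)[OF assms], of "clash r n"]] by simp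
  also have "\<dots> \<le> (\<Sum>h\<in>F. N * \<delta>)"
    using LinD(1)[OF assms] by (intro sum_mono card_clash_le) auto
  also have "\<dots> = real f * (N * \<delta>)" using LinD(3)[OF assms] by simp
  finally have *: "real (card (\<Union>h\<in>F. clash r n h)) \<le> real f * (N * \<delta>)" .
  have "card (edges r n) - card (\<Union>h\<in>F. clash r n h) \<le> card (addable r n F)"
    unfolding addable_eq by (rule diff_card_le_card_Diff) (auto simp: LinD(4)[OF assms] finite_clash)
  then have "N - real (card (\<Union>h\<in>F. clash r n h)) \<le> real (card (addable r n F))"
    unfolding N_def card_edges[symmetric] by linarith
  then show ?thesis using * by (simp add: algebra_simps)
qed

lemma A_Suc_upper:
  assumes "F \<in> Lin r n f"
  shows "real (Suc M - f) * A (Suc M) F \<le> N * A M F"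
proof -
  have "real (Suc M - f) * A (Suc M) F = (\<Sum>g\<in>addable r n F. A (Suc M) (insert g F))"
    using sum_A_insert[OF assms] by simp
  also have "\<dots> \<le> (\<Sum>g\<in>addable r n F. A M F)" by (intro sum_mono A_insert_le[OF assms])
  also have "\<dots> \<le> N * A M F" using card_addable_le by (simp add: mult_right_mono)
  finally show ?thesis .
qed

text \<open>Exchanging the order of summation avoids any knowledge of individual \<open>g\<close>:
  the edges that can be added to an extension \<open>H\<close> are counted instead, and a union
  bound over its \<open>M\<close> edges leaves at least \<open>N * (1 - M * \<delta>)\<close> of
  them.\<close>

lemma A_Suc_lower:
  assumes F: "F \<in> Lin r n f"
  shows "N * (1 - real M * \<delta>) * A M F \<le> real (Suc M - f) * A (Suc M) F"
proof -
  have count: "(\<Sum>g\<in>addable r n F. card {H \<in> extensions r n M F. H \<inter> clash r n g = {}})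
      = (\<Sum>H\<in>extensions r n M F. card (addable r n H))"
  proof (rule sum_multicount_gen)
    show "\<forall>H\<in>extensions r n M F. card {g \<in> addable r n F. H \<inter> clash r n g = {}} = card (addable r n H)"
    proof
      fix H assume "H \<in> extensions r n M F"
      then have "F \<subseteq> H" "H \<subseteq> edges r n" by (auto simp: extensions_def dest: LinD(1))
      then have "{g \<in> addable r n F. H \<inter> clash r n g = {}} = addable r n H"
        by (fastforce simp: addable_def clash_def Int_commute)
      then show "card {g \<in> addable r n F. H \<inter> clash r n g = {}} = card (addable r n H)" by simp
    qed
  qed (auto simp: finite_addable finite_extensions)
  have "N * (1 - real M * \<delta>) * A M F = (\<Sum>H\<in>extensions r n M F. N * (1 - real M * \<delta>))" by simp
  also have "\<dots> \<le> (\<Sum>H\<in>extensions r n M F. real (card (addable r n H)))"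
    by (intro sum_mono card_addable_ge) (simp add: extensions_def)
  also have "\<dots> = (\<Sum>g\<in>addable r n F. A (Suc M) (insert g F))"
    using count card_extensions_Suc_insert[OF r2 F] by (simp flip: of_nat_sum)
  also have "\<dots> = real (Suc M - f) * A (Suc M) F" by (rule sum_A_insert[OF F])
  finally show ?thesis .
qed

text \<open>Starting from \<open>F\<close> itself, extensions can be enlarged greedily as long as
  the union bound leaves an addable edge. This legitimises later divisions by
  \<open>A\<close>.\<close>

lemma A_pos:
  assumes F: "F \<in> Lin r n f" and "real M * \<delta> < 1" "f \<le> M"
  shows "0 < A M F"
  using assms(3,2)
proof (induction rule: dec_induct)
  case base
  then show ?case using extensions_self[OF F] by simp
next
  case (step M)
  have M: "real M * \<delta> < 1"
    using step(4) delta_nonneg mult_right_mono[of "real M" "real (Suc M)" \<delta>] by simp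
  then have "0 < N * (1 - real M * \<delta>) * A M F" using step N_pos by simp
  also have "\<dots> \<le> real (Suc M - f) * A (Suc M) F" by (rule A_Suc_lower[OF F])
  finally show ?case by (simp add: zero_less_mult_iff)
qed

end

section \<open>Clash probabilities in the sparse range\<close>

text \<open>The constant 1/56 makes the relative error \<open>28 * \<beta>\<close> of a single edge
  step at most 1/2, as the logarithm estimates there require.\<close>

locale sparse_range_edges = sparse_range +
  fixes m :: nat
  assumes m_delta: "real m * \<delta> \<le> 1/56"
begin

definition \<eta> :: real where "\<eta> = real m * \<delta>"

text \<open>The error unit for adding one edge. The first entry comes from second-order counting,
  the second from trivial bounds; they lead to the two entries of the minimum in the
  theorem.\<close>

definition \<beta> :: real where "\<beta> = min (real m ^ 2 * \<rho>) \<eta>"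

lemma eta_bounds: "0 \<le> \<eta>" "\<eta> \<le> 1/56"
  using m_delta delta_nonneg by (auto simp: \<eta>_def)

lemma eta_sq_le: "\<eta>\<^sup>2 \<le> real m ^ 2 * \<rho>"
  unfolding \<eta>_def power_mult_distrib by (intro mult_left_mono delta_sq_le) simp

lemma eta_sq_le_beta: "\<eta>\<^sup>2 \<le> \<beta>"
  using eta_sq_le eta_bounds mult_right_mono[of \<eta> 1 \<eta>] by (simp add: \<beta>_def power2_eq_square)

lemma beta_bounds: "0 \<le> \<beta>" "\<beta> \<le> \<eta>" "\<beta> \<le> real m ^ 2 * \<rho>"
  using eta_bounds rho_nonneg by (auto simp: \<beta>_def)

lemma mult_delta_le_eta: "real j * \<delta> \<le> \<eta>" if "j \<le> m" for j
  unfolding \<eta>_def using that delta_nonneg by (intro mult_right_mono) auto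

text \<open>Passing from \<open>F + g\<close> with \<open>M\<close> edges to \<open>F\<close> with
  \<open>M - 1\<close> edges only loses graphs, and \<open>A_Suc_lower\<close> converts back to
  \<open>M\<close> edges. The factor \<open>1 + 2 * \<eta>\<close> bounds the reciprocal of
  \<open>1 - \<eta>\<close>. For \<open>M \<le> f\<close> no extension contains
  \<open>g\<close>.\<close>

lemma A_insert_upper:
  assumes F: "F \<in> Lin r n f" and g: "g \<in> addable r n F" and M: "M \<le> m"
  shows "A M (insert g F) \<le> real (M - f) / N * (1 + 2 * \<eta>) * A M F"
proof (cases "M \<le> f")
  case True
  have "extensions r n M (insert g F) = {}"
    using LinD(3,4)[OF Lin_insert[OF r2 F g]] True by (intro extensions_empty_if_card_gt) auto
  then show ?thesis using True by simp
next
  case False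
  then obtain M' where M': "M = Suc M'" by (cases M) auto
  have "1 \<le> (1 - \<eta>) * (1 + 2 * \<eta>)"
  proof -
    have "\<eta> * (1 - 2 * \<eta>) \<ge> 0" using eta_bounds by simp
    then show ?thesis by (simp add: algebra_simps)
  qed
  moreover have "(1 - \<eta>) * (1 + 2 * \<eta>) \<le> (1 - real M' * \<delta>) * (1 + 2 * \<eta>)"
    using mult_delta_le_eta[of M'] M M' eta_bounds by (intro mult_right_mono) auto
  ultimately have "1 \<le> (1 - real M' * \<delta>) * (1 + 2 * \<eta>)" by linarith
  then have "A M' F \<le> (1 - real M' * \<delta>) * (1 + 2 * \<eta>) * A M' F"
    using mult_right_mono[of 1 _ "A M' F"] by simp
  also have "\<dots> = (1 + 2 * \<eta>) / N * (N * (1 - real M' * \<delta>) * A M' F)" using N_pos by simp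
  also have "\<dots> \<le> (1 + 2 * \<eta>) / N * (real (M - f) * A M F)"
    unfolding M' using eta_bounds N_pos by (intro mult_left_mono A_Suc_lower[OF F]) auto
  finally have "A M' F \<le> real (M - f) / N * (1 + 2 * \<eta>) * A M F" by (simp add: mult_ac)
  then show ?thesis using A_insert_le[OF F g, of M'] M' by simp
qed

text \<open>An edge of \<open>H\<close> that clashes with the addable edge \<open>g\<close> cannot
  lie in \<open>F\<close>, so it is itself addable. This turns \<open>bad\<close> into a union to
  which the union bound and Bonferroni apply.\<close>

lemma bad_set_eq:
  assumes F: "F \<in> Lin r n f" and g: "g \<in> addable r n F"
  shows "{H \<in> extensions r n M F. H \<inter> clash r n g \<noteq> {}} = (\<Union>h\<in>clash r n g \<inter> addable r n F. extensions r n M (insert h F))"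
proof -
  have "h \<in> addable r n F" if "H \<in> extensions r n M F" "h \<in> H" "h \<in> clash r n g" for H h
  proof -
    have "h \<notin> F" using that(3) g by (auto simp: clash_def addable_def Int_commute)
    then show ?thesis using extensions_Int_addable[OF r2 that(1)] that(2) by blast
  qed
  then show ?thesis by (auto simp: extensions_insert_eq)
qed

lemma card_clash_Int_addable_le:
  assumes "g \<in> edges r n"
  shows "real (card (clash r n g \<inter> addable r n F)) \<le> N * \<delta>"
proof -
  have "card (clash r n g \<inter> addable r n F) \<le> card (clash r n g)"
    by (intro card_mono finite_clash) auto
  then show ?thesis using card_clash_le[OF assms] by linarith
qed

text \<open>Each of the \<open>f\<close> edges of \<open>F\<close> removes at most
  \<open>N * \<rho>\<close> members of \<open>clash r n g\<close>, because \<open>g\<close> meets it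
  in at most one vertex.\<close>

lemma card_clash_Int_addable_ge:
  assumes F: "F \<in> Lin r n f" and g: "g \<in> addable r n F"
  shows "N * (\<delta> - \<rho> - real f * \<rho>) \<le> real (card (clash r n g \<inter> addable r n F))"
proof -
  have gE: "g \<in> edges r n" using g by (simp add: addable_def)
  have "clash r n g \<inter> addable r n F = clash r n g - (\<Union>h\<in>F. clash r n g \<inter> clash r n h)"
    by (auto simp: addable_eq clash_def)
  then have "card (clash r n g) - card (\<Union>h\<in>F. clash r n g \<inter> clash r n h) \<le> card (clash r n g \<inter> addable r n F)"
    using diff_card_le_card_Diff[of "\<Union>h\<in>F. clash r n g \<inter> clash r n h" "clash r n g"] LinD(4)[OF F]
    by (auto simp: finite_clash)
  moreover have "real (card (\<Union>h\<in>F. clash r n g \<inter> clash r n h)) \<le> real f * (N * \<rho>)"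
  proof -
    have "real (card (\<Union>h\<in>F. clash r n g \<inter> clash r n h)) \<le> (\<Sum>h\<in>F. real (card (clash r n g \<inter> clash r n h)))"
      using of_nat_mono[OF card_UN_le[OF LinD(4)[OF F], of "\<lambda>h. clash r n g \<inter> clash r n h"]]
      by (simp only: of_nat_sum)
    also have "\<dots> \<le> (\<Sum>h\<in>F. N * \<rho>)"
      using LinD(1)[OF F] g gE by (intro sum_mono card_clash_Int_le) (auto simp: addable_def)
    finally show ?thesis using LinD(3)[OF F] by simp
  qed
  ultimately show ?thesis using card_clash_ge[OF gE] by (simp add: algebra_simps)
qed

lemma bad_le:
  assumes F: "F \<in> Lin r n f" and g: "g \<in> addable r n F" and M: "M \<le> m"
  shows "bad M F g \<le> real (M - f) * \<delta> * (1 + 2 * \<eta>) * A M F"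
proof -
  let ?I = "clash r n g \<inter> addable r n F"
  let ?q = "real (M - f) / N * (1 + 2 * \<eta>) * A M F"
  have gE: "g \<in> edges r n" using g by (simp add: addable_def)
  have "bad M F g \<le> (\<Sum>h\<in>?I. A M (insert h F))"
    unfolding bad_set_eq[OF F g]
    using of_nat_mono[OF card_UN_le[of ?I "\<lambda>h. extensions r n M (insert h F)"]] by (simp add: finite_clash)
  also have "\<dots> \<le> (\<Sum>h\<in>?I. ?q)" by (intro sum_mono A_insert_upper[OF F _ M]) auto
  also have "\<dots> = real (card ?I) * ?q" by simp
  also have "\<dots> \<le> N * \<delta> * ?q"
    using card_clash_Int_addable_le[OF gE, of F] eta_bounds N_pos by (intro mult_right_mono) auto
  also have "\<dots> = real (M - f) * \<delta> * (1 + 2 * \<eta>) * A M F" using N_pos by simp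
  finally show ?thesis .
qed

lemma bad_le_eta:
  assumes F: "F \<in> Lin r n f" and g: "g \<in> addable r n F" and M: "M \<le> m"
  shows "bad M F g \<le> 2 * \<eta> * A M F"
proof -
  have "real (M - f) * \<delta> * (1 + 2 * \<eta>) \<le> \<eta> * 2"
    using mult_delta_le_eta[of "M - f"] M eta_bounds by (intro mult_mono) auto
  then have "real (M - f) * \<delta> * (1 + 2 * \<eta>) * A M F \<le> \<eta> * 2 * A M F"
    by (intro mult_right_mono) auto
  then show ?thesis using bad_le[OF assms] by linarith
qed

text \<open>The upper bound on clashes, applied with \<open>M - 1\<close> edges, shows that
  \<open>g\<close> can be added to all but a fraction \<open>2 * \<eta>\<close> of the
  extensions.\<close>

lemma A_insert_lower:
  assumes F: "F \<in> Lin r n f" and g: "g \<in> addable r n F" and M: "M \<le> m"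
  shows "real (M - f) / N * (1 - 2 * \<eta>) * A M F \<le> A M (insert g F)"
proof (cases "M \<le> f")
  case False
  then obtain M' where M': "M = Suc M'" by (cases M) auto
  have "real (M - f) / N * (1 - 2 * \<eta>) * A M F = (1 - 2 * \<eta>) / N * (real (Suc M' - f) * A (Suc M') F)"
    unfolding M' by simp
  also have "\<dots> \<le> (1 - 2 * \<eta>) / N * (N * A M' F)"
    using eta_bounds N_pos by (intro mult_left_mono A_Suc_upper[OF F]) auto
  also have "\<dots> = (1 - 2 * \<eta>) * A M' F" using N_pos by simp
  also have "\<dots> = A M' F - 2 * \<eta> * A M' F" by (simp add: left_diff_distrib)
  also have "\<dots> \<le> A M (insert g F)"
    using bad_le_eta[OF F g, of M'] A_insert_eq[OF F g, of M'] M M' by simp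
  finally show ?thesis .
qed simp

text \<open>If \<open>h\<close> and \<open>h'\<close> are compatible, the one-edge bound is applied
  twice; otherwise no linear \<open>r\<close>-graph contains both.\<close>

lemma card_extensions_pair_le:
  assumes F: "F \<in> Lin r n f" and h: "h \<in> addable r n F" "h' \<in> addable r n F" "h \<noteq> h'" and M: "M \<le> m"
  shows "real (card (extensions r n M (insert h F) \<inter> extensions r n M (insert h' F)))
    \<le> (real (M - f) / N * (1 + 2 * \<eta>))\<^sup>2 * A M F"
proof (cases "h' \<in> addable r n (insert h F)")
  case True
  let ?q = "real (M - f) / N * (1 + 2 * \<eta>)"
  have q0: "0 \<le> ?q" using eta_bounds N_pos by simp
  have "real (card (extensions r n M (insert h F) \<inter> extensions r n M (insert h' F))) = A M (insert h' (insert h F))"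
    by (intro arg_cong[where f = "\<lambda>x. real (card x)"]) (auto simp: extensions_def)
  also have "\<dots> \<le> real (M - Suc f) / N * (1 + 2 * \<eta>) * A M (insert h F)"
    by (intro A_insert_upper[OF _ True M] Lin_insert[OF r2 F h(1)])
  also have "\<dots> \<le> ?q * A M (insert h F)"
    using eta_bounds N_pos by (intro mult_right_mono divide_right_mono) auto
  also have "\<dots> \<le> ?q * (?q * A M F)"
    by (intro mult_left_mono q0 A_insert_upper[OF F h(1) M])
  finally show ?thesis by (simp add: power2_eq_square mult_ac)
next
  case False
  have "extensions r n M (insert h F) \<inter> extensions r n M (insert h' F) = {}"
  proof (rule ccontr)
    assume "\<not> ?thesis"
    then obtain H where "H \<in> extensions r n M (insert h F)" "H \<in> extensions r n M (insert h' F)" by blast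
    then have H: "H \<in> Lin r n M" "h \<in> H" "h' \<in> H" by (auto simp: extensions_def)
    then have "card (h' \<inter> h) \<le> 1" using LinD(2)[OF H(1)] h(3) by (auto simp: linear_hg_def)
    then show False using False h(2) by (simp add: addable_def)
  qed
  then show ?thesis by simp
qed

text \<open>Bonferroni over the addable edges clashing with \<open>g\<close>. The single terms lose
  \<open>2 * \<eta>^2\<close> and \<open>m^2 * \<rho>\<close>, the pairs lose
  \<open>4 * \<eta>^2\<close>; since \<open>\<eta>^2 \<le> m^2 * \<rho>\<close>, the total is
  7.\<close>

lemma bad_ge:
  assumes F: "F \<in> Lin r n f" and g: "g \<in> addable r n F" and M: "M < m" "f \<le> M"
  shows "(real (M - f) * \<delta> - 7 * (real m ^ 2 * \<rho>)) * A M F \<le> bad M F g"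
proof -
  let ?I = "clash r n g \<inter> addable r n F"
  define p where "p = real (M - f)"
  define q where "q = p / N * (1 + 2 * \<eta>)"
  have Mm: "M \<le> m" using M by simp
  have gE: "g \<in> edges r n" using g by (simp add: addable_def)
  have finI: "finite ?I" using finite_clash by blast
  have p: "0 \<le> p" "p * \<delta> \<le> \<eta>" unfolding p_def using mult_delta_le_eta[of "M - f"] M by auto
  have q0: "0 \<le> q" unfolding q_def using p eta_bounds N_pos by simp
  have cI: "real (card ?I) \<le> N * \<delta>" by (rule card_clash_Int_addable_le[OF gE])

  have single: "(p * \<delta> - 2 * \<eta>\<^sup>2 - real m ^ 2 * \<rho>) * A M F \<le> (\<Sum>h\<in>?I. A M (insert h F))"
  proof -
    \<comment> \<open>The loss \<rho> occurs \<open>f + 1\<close> times: once for the size of the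
      clash set and once for each edge of \<open>F\<close>. Since \<open>f \<le> M < m\<close>, the
      factor \<open>f + 1\<close> is at most \<open>m\<close>.\<close>
    have "real (Suc f) * p \<le> real m * real m"
      unfolding p_def using M by (intro mult_mono) auto
    then have *: "(real (Suc f) * p) * \<rho> \<le> real m ^ 2 * \<rho>"
      using rho_nonneg by (intro mult_right_mono) (auto simp: power2_eq_square)
    have "p * \<delta> * (2 * \<eta>) \<le> \<eta> * (2 * \<eta>)" using p eta_bounds by (intro mult_right_mono) auto
    moreover have "0 \<le> (real (Suc f) * p) * \<rho> * (2 * \<eta>)" using p eta_bounds rho_nonneg by simp
    moreover have "(\<delta> - \<rho> - real f * \<rho>) * p * (1 - 2 * \<eta>)
        = p * \<delta> - p * \<delta> * (2 * \<eta>) - (real (Suc f) * p) * \<rho> + (real (Suc f) * p) * \<rho> * (2 * \<eta>)"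
      by (simp add: algebra_simps)
    ultimately have "p * \<delta> - 2 * \<eta>\<^sup>2 - real m ^ 2 * \<rho> \<le> (\<delta> - \<rho> - real f * \<rho>) * p * (1 - 2 * \<eta>)"
      using * unfolding power2_eq_square by linarith
    also have "\<dots> = N * (\<delta> - \<rho> - real f * \<rho>) * (p / N * (1 - 2 * \<eta>))" using N_pos by simp
    also have "\<dots> \<le> real (card ?I) * (p / N * (1 - 2 * \<eta>))"
      using card_clash_Int_addable_ge[OF F g] p eta_bounds N_pos by (intro mult_right_mono) auto
    finally have "(p * \<delta> - 2 * \<eta>\<^sup>2 - real m ^ 2 * \<rho>) * A M F
        \<le> real (card ?I) * (p / N * (1 - 2 * \<eta>)) * A M F"
      by (intro mult_right_mono) auto
    also have "\<dots> = (\<Sum>h\<in>?I. p / N * (1 - 2 * \<eta>) * A M F)" by simp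
    also have "\<dots> \<le> (\<Sum>h\<in>?I. A M (insert h F))"
      unfolding p_def by (intro sum_mono A_insert_lower[OF F _ Mm]) auto
    finally show ?thesis .
  qed

  have pair: "(\<Sum>h\<in>?I. \<Sum>h'\<in>?I - {h}. real (card (extensions r n M (insert h F) \<inter> extensions r n M (insert h' F))))
      \<le> 4 * \<eta>\<^sup>2 * A M F"
  proof -
    have "(\<Sum>h\<in>?I. \<Sum>h'\<in>?I - {h}. real (card (extensions r n M (insert h F) \<inter> extensions r n M (insert h' F))))
        \<le> (\<Sum>h\<in>?I. \<Sum>h'\<in>?I - {h}. q\<^sup>2 * A M F)"
      unfolding q_def p_def by (intro sum_mono card_extensions_pair_le[OF F _ _ _ Mm]) auto
    \<comment> \<open>Restoring the diagonal makes the double sum a perfect square.\<close>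
    also have "\<dots> \<le> (\<Sum>h\<in>?I. \<Sum>h'\<in>?I. q\<^sup>2 * A M F)"
      using finI by (intro sum_mono sum_mono2) auto
    also have "\<dots> = (real (card ?I) * q)\<^sup>2 * A M F" by (simp add: power2_eq_square)
    also have "\<dots> \<le> (2 * \<eta>)\<^sup>2 * A M F"
    proof (intro mult_right_mono power_mono)
      have "real (card ?I) * q \<le> N * \<delta> * q" using cI q0 by (rule mult_right_mono)
      also have "\<dots> = p * \<delta> * (1 + 2 * \<eta>)" unfolding q_def using N_pos by simp
      also have "\<dots> \<le> \<eta> * 2" using p eta_bounds by (intro mult_mono) auto
      finally show "real (card ?I) * q \<le> 2 * \<eta>" by simp
    qed (use q0 in auto)
    finally show ?thesis by (simp add: power_mult_distrib)
  qed

  have "(\<Sum>h\<in>?I. A M (insert h F)) \<le> bad M F g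
      + (\<Sum>h\<in>?I. \<Sum>h'\<in>?I - {h}. real (card (extensions r n M (insert h F) \<inter> extensions r n M (insert h' F))))"
    unfolding bad_set_eq[OF F g]
    using of_nat_mono[where 'a = real, OF bonferroni_card_UN[OF finI, of "\<lambda>h. extensions r n M (insert h F)"]]
    by (simp add: finite_extensions)
  then have "(p * \<delta> - 2 * \<eta>\<^sup>2 - real m ^ 2 * \<rho>) * A M F - 4 * \<eta>\<^sup>2 * A M F \<le> bad M F g"
    using single pair by linarith
  then have "(p * \<delta> - 6 * \<eta>\<^sup>2 - real m ^ 2 * \<rho>) * A M F \<le> bad M F g"
    by (simp add: algebra_simps)
  moreover have "(p * \<delta> - 7 * (real m ^ 2 * \<rho>)) * A M F \<le> (p * \<delta> - 6 * \<eta>\<^sup>2 - real m ^ 2 * \<rho>) * A M F"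
    using eta_sq_le by (intro mult_right_mono) (auto simp: mult.commute)
  ultimately show ?thesis unfolding p_def by linarith
qed

text \<open>The main term does not depend on \<open>g\<close>, which is what makes the summands in
  the double count almost equal. When \<eta> is the smaller entry of \<beta>, the lower estimate is
  trivial: \<open>bad\<close> is nonnegative and the main term is at most
  \<open>\<eta> * A M F\<close>.\<close>

lemma bad_approx:
  assumes F: "F \<in> Lin r n f" and g: "g \<in> addable r n F" and M: "M < m" "f \<le> M"
  shows "\<bar>bad M F g - real (M - f) * \<delta> * A M F\<bar> \<le> 7 * \<beta> * A M F"
proof -
  define c where "c = real (M - f) * \<delta>"
  have c: "0 \<le> c" "c \<le> \<eta>" unfolding c_def using mult_delta_le_eta[of "M - f"] M delta_nonneg by auto
  have A0: "0 \<le> A M F" by simp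
  have up: "bad M F g - c * A M F \<le> 7 * \<beta> * A M F"
  proof -
    have "c * (2 * \<eta>) \<le> \<eta> * (2 * \<eta>)" using c eta_bounds by (intro mult_right_mono) auto
    then have "c * (2 * \<eta>) \<le> 7 * \<beta>" using eta_sq_le_beta beta_bounds by (simp add: power2_eq_square)
    then have "c * (2 * \<eta>) * A M F \<le> 7 * \<beta> * A M F" by (intro mult_right_mono) auto
    then show ?thesis using bad_le[OF F g, of M] M by (simp add: c_def algebra_simps)
  qed
  have lo1: "c * A M F - bad M F g \<le> 7 * (real m ^ 2 * \<rho>) * A M F"
    using bad_ge[OF assms] by (simp add: c_def algebra_simps)
  have lo2: "c * A M F - bad M F g \<le> 7 * \<eta> * A M F"
  proof -
    have "c * A M F \<le> 7 * \<eta> * A M F" using c by (intro mult_right_mono) auto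
    then show ?thesis by linarith
  qed
  have "c * A M F - bad M F g \<le> 7 * \<beta> * A M F"
    using lo1 lo2 by (cases "real m ^ 2 * \<rho> \<le> \<eta>") (auto simp: \<beta>_def min_def)
  then show ?thesis using up unfolding c_def by linarith
qed

text \<open>Bonferroni for the clash sets of the edges of \<open>F\<close>: the losses
  \<open>f * \<rho>\<close> and \<open>f * (f - 1) * \<rho>\<close> add up to
  \<open>f^2 * \<rho>\<close>. The alternative error \<eta> comes from the trivial bound
  \<open>N\<close>.\<close>

lemma card_addable_approx:
  assumes F: "F \<in> Lin r n f" and f: "f \<le> m"
  shows "real (card (addable r n F)) \<le> N * (1 - real f * \<delta> + \<beta>)"
proof -
  have finF: "finite F" using LinD(4)[OF F] .
  have "(\<Sum>h\<in>F. real (card (clash r n h))) \<le> real (card (\<Union>h\<in>F. clash r n h))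
      + (\<Sum>h\<in>F. \<Sum>h'\<in>F - {h}. real (card (clash r n h \<inter> clash r n h')))"
    using of_nat_mono[where 'a = real, OF bonferroni_card_UN[OF finF, of "clash r n"]]
    by (simp add: finite_clash)
  moreover have "real f * (N * (\<delta> - \<rho>)) \<le> (\<Sum>h\<in>F. real (card (clash r n h)))"
  proof -
    have "(\<Sum>h\<in>F. N * (\<delta> - \<rho>)) \<le> (\<Sum>h\<in>F. real (card (clash r n h)))"
      using LinD(1)[OF F] by (intro sum_mono card_clash_ge) auto
    then show ?thesis using LinD(3)[OF F] by simp
  qed
  moreover have "(\<Sum>h\<in>F. \<Sum>h'\<in>F - {h}. real (card (clash r n h \<inter> clash r n h')))
      \<le> real f * ((real f - 1) * (N * \<rho>))"
  proof -
    have "(\<Sum>h\<in>F. \<Sum>h'\<in>F - {h}. real (card (clash r n h \<inter> clash r n h')))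
        \<le> (\<Sum>h\<in>F. \<Sum>h'\<in>F - {h}. N * \<rho>)"
      using LinD(1,2)[OF F] by (intro sum_mono card_clash_Int_le) (auto simp: linear_hg_def)
    also have "\<dots> = (\<Sum>h\<in>F. (real f - 1) * (N * \<rho>))"
    proof (intro sum.cong refl)
      fix h assume h: "h \<in> F"
      then have "card (F - {h}) = f - 1" "1 \<le> f"
        using LinD(3)[OF F] finF by (auto simp: Suc_le_eq card_gt_0_iff)
      then show "(\<Sum>h'\<in>F - {h}. N * \<rho>) = (real f - 1) * (N * \<rho>)" by (simp add: of_nat_diff)
    qed
    finally show ?thesis using LinD(3)[OF F] by simp
  qed
  ultimately have "real f * (N * (\<delta> - \<rho>)) - real f * ((real f - 1) * (N * \<rho>)) \<le> real (card (\<Union>h\<in>F. clash r n h))"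
    by linarith
  then have W: "N * (real f * \<delta> - real f ^ 2 * \<rho>) \<le> real (card (\<Union>h\<in>F. clash r n h))"
    by (simp add: algebra_simps power2_eq_square)
  have "card (addable r n F) = card (edges r n) - card (\<Union>h\<in>F. clash r n h)"
    unfolding addable_eq by (intro card_Diff_subset) (use finF finite_clash in \<open>auto simp: clash_def\<close>)
  moreover have "card (\<Union>h\<in>F. clash r n h) \<le> card (edges r n)"
    by (intro card_mono finite_edges) (auto simp: clash_def)
  ultimately have eq: "real (card (addable r n F)) = N - real (card (\<Union>h\<in>F. clash r n h))"
    unfolding N_def card_edges[symmetric] by (simp add: of_nat_diff)
  have "real f ^ 2 * \<rho> \<le> real m ^ 2 * \<rho>"
    using f rho_nonneg by (intro mult_right_mono power_mono) auto
  then have "N * (real f * \<delta> - real m ^ 2 * \<rho>) \<le> N * (real f * \<delta> - real f ^ 2 * \<rho>)"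
    using N_pos by (intro mult_left_mono) auto
  then have b1: "real (card (addable r n F)) \<le> N * (1 - real f * \<delta> + real m ^ 2 * \<rho>)"
    using W eq by (simp add: algebra_simps)
  have "N * (real f * \<delta>) \<le> N * \<eta>" using mult_delta_le_eta[OF f] N_pos by (intro mult_left_mono) auto
  then have b2: "real (card (addable r n F)) \<le> N * (1 - real f * \<delta> + \<eta>)"
    using card_addable_le[of F] by (simp add: algebra_simps)
  show ?thesis using b1 b2 by (simp add: \<beta>_def min_def)
qed

section \<open>Adding one edge, and multiplying over all edges\<close>

text \<open>Here \<open>A m (insert g F)\<close> equals \<open>A0 * (1 - b g)\<close>, while
  \<open>(m - f) * A m F\<close> equals \<open>A0 * X\<close>. Since \<open>X\<close> is close to
  \<open>G * (1 - b g)\<close>, the unknown factor \<open>1 - b g\<close> cancels in the quotient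
  and only the number \<open>G\<close> of addable edges remains.\<close>

lemma A_insert_approx:
  assumes F: "F \<in> Lin r n f" and g: "g \<in> addable r n F" and f: "f < m"
  shows "\<exists>x. \<bar>x\<bar> \<le> 59 * \<beta> \<and>
    A m (insert g F) = real (m - f) / N * exp (real f * \<delta> + x) * A m F"
proof -
  obtain M where M: "m = Suc M" using f by (cases m) auto
  then have Mm: "M < m" "f \<le> M" using f by auto
  define A0 where "A0 = A M F"
  define b where "b h = bad M F h / A0" for h
  define c where "c = real (M - f) * \<delta>"
  define G where "G = real (card (addable r n F))"
  define X where "X = (\<Sum>h\<in>addable r n F. 1 - b h)"
  have "real M * \<delta> < 1" using mult_delta_le_eta[of M] Mm eta_bounds by simp
  then have A0: "0 < A0" unfolding A0_def using A_pos[OF F _ Mm(2)] by simp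
  have bad_eq: "bad M F h = A0 * b h" for h unfolding b_def using A0 by simp
  have ins: "A m (insert h F) = A0 * (1 - b h)" if "h \<in> addable r n F" for h
    unfolding M using A_insert_eq[OF F that, of M] bad_eq[of h] A0_def by (simp add: algebra_simps)
  have X_eq: "A0 * X = real (m - f) * A m F"
    unfolding X_def sum_distrib_left sum_A_insert[OF F, of m, symmetric]
    by (intro sum.cong refl) (simp add: ins)
  have b_close: "\<bar>b h - c\<bar> \<le> 7 * \<beta>" if "h \<in> addable r n F" for h
  proof -
    have "\<bar>A0 * (b h - c)\<bar> \<le> A0 * (7 * \<beta>)"
      using bad_approx[OF F that Mm] bad_eq[of h] by (simp add: A0_def c_def algebra_simps)
    then have "A0 * \<bar>b h - c\<bar> \<le> A0 * (7 * \<beta>)" using A0 by (simp add: abs_mult)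
    then show ?thesis using A0 by simp
  qed
  have bg: "b g \<le> 1/2"
  proof -
    have "A0 * b g \<le> A0 * (2 * \<eta>)"
      using bad_le_eta[OF F g, of M] Mm bad_eq[of g] by (simp add: A0_def mult_ac)
    then have "b g \<le> 2 * \<eta>" using A0 by simp
    then show ?thesis using eta_bounds by simp
  qed
  \<comment> \<open>Both \<open>b g\<close> and \<open>b h\<close> lie within
    \<open>7 * \<beta>\<close> of the common value \<open>c\<close>, hence the 14.\<close>
  have X_close: "\<bar>X - G * (1 - b g)\<bar> \<le> G * (14 * \<beta>)"
  proof -
    have "X - G * (1 - b g) = (\<Sum>h\<in>addable r n F. b g - b h)"
      unfolding X_def G_def by (simp add: sum_subtractf algebra_simps)
    also have "\<bar>\<dots>\<bar> \<le> (\<Sum>h\<in>addable r n F. \<bar>b g - b h\<bar>)" by (rule sum_abs)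
    also have "\<dots> \<le> (\<Sum>h\<in>addable r n F. 14 * \<beta>)"
    proof (intro sum_mono)
      fix h assume "h \<in> addable r n F"
      then show "\<bar>b g - b h\<bar> \<le> 14 * \<beta>" using b_close[of h] b_close[OF g] by linarith
    qed
    finally show ?thesis unfolding G_def by simp
  qed
  \<comment> \<open>The fraction of edges that are not addable. The union bound gives
    \<open>w \<le> f * \<delta>\<close>, and Bonferroni gives the matching lower bound up to
    \<beta>.\<close>
  define w where "w = 1 - G / N"
  have G_eq: "G = N * (1 - w)" unfolding w_def using N_pos by simp
  have fd: "real f * \<delta> \<le> \<eta>" using mult_delta_le_eta[of f] f by simp
  have "N * (1 - real f * \<delta>) \<le> N * (1 - w)"
    using card_addable_ge[OF F] G_eq by (simp add: G_def)
  then have w_up: "w \<le> real f * \<delta>" using N_pos by simp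
  have "N * (1 - w) \<le> N * (1 - real f * \<delta> + \<beta>)"
    using card_addable_approx[OF F] f G_eq by (simp add: G_def)
  then have "1 - w \<le> 1 - real f * \<delta> + \<beta>" using N_pos by (simp only: mult_le_cancel_left_pos)
  then have w_lo: "real f * \<delta> - \<beta> \<le> w" by simp
  have "N * (1 - w) \<le> N * 1" using card_addable_le[of F] G_eq by (simp add: G_def)
  then have w0: "0 \<le> w" using N_pos by simp
  have w_small: "w \<le> \<eta>" "w \<le> 1/56" using w_up fd eta_bounds by auto
  have Gpos: "0 < G" unfolding G_eq using N_pos w_small by simp
  \<comment> \<open>The relative error of replacing \<open>X\<close> by
    \<open>G * (1 - b g)\<close>; dividing by \<open>1 - b g \<ge> 1/2\<close> doubles 14 to
    28.\<close>
  define \<theta> where "\<theta> = X / (G * (1 - b g)) - 1"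
  have den: "0 < G * (1 - b g)" using Gpos bg by simp
  have X_theta: "X = G * (1 - b g) * (1 + \<theta>)"
    unfolding \<theta>_def using less_imp_neq[OF den] by (simp del: mult_eq_0_iff)
  have th: "\<bar>\<theta>\<bar> \<le> 28 * \<beta>"
  proof -
    have "\<bar>G * (1 - b g) * \<theta>\<bar> \<le> G * (14 * \<beta>)"
      using X_close unfolding X_theta by (simp add: algebra_simps)
    then have "G * ((1 - b g) * \<bar>\<theta>\<bar>) \<le> G * (14 * \<beta>)" using Gpos bg by (simp add: abs_mult)
    then have "(1 - b g) * \<bar>\<theta>\<bar> \<le> 14 * \<beta>" using Gpos by simp
    moreover have "1/2 * \<bar>\<theta>\<bar> \<le> (1 - b g) * \<bar>\<theta>\<bar>" using bg by (intro mult_right_mono) auto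
    ultimately show ?thesis by linarith
  qed
  then have th_half: "\<bar>\<theta>\<bar> \<le> 1/2" using beta_bounds eta_bounds by linarith
  have lnw: "\<bar>ln (1 - w) + w\<bar> \<le> 2 * \<beta>"
  proof -
    have "\<bar>ln (1 + - w) - - w\<bar> \<le> 2 * (- w)\<^sup>2"
      using w_small w0 by (intro abs_ln_one_plus_x_minus_x_bound) auto
    moreover have "w\<^sup>2 \<le> \<eta>\<^sup>2" using w0 w_small by (intro power_mono) auto
    ultimately show ?thesis using eta_sq_le_beta by simp
  qed
  \<comment> \<open>For \<open>\<bar>\<theta>\<bar> \<le> 1/2\<close> the logarithm is at most
    \<open>2 * \<bar>\<theta>\<bar>\<close> in absolute value, which doubles 28 to 56.\<close>
  have lnth: "\<bar>ln (1 + \<theta>)\<bar> \<le> 56 * \<beta>"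
  proof -
    have "\<bar>ln (1 + \<theta>) - \<theta>\<bar> \<le> 2 * \<theta>\<^sup>2" by (rule abs_ln_one_plus_x_minus_x_bound[OF th_half])
    moreover have "2 * \<theta>\<^sup>2 \<le> \<bar>\<theta>\<bar>"
      using mult_right_mono[OF th_half, of "\<bar>\<theta>\<bar>"] by (simp add: power2_eq_square abs_mult_self_eq)
    ultimately show ?thesis using th by linarith
  qed
  define x where "x = - ln (1 - w) - ln (1 + \<theta>) - real f * \<delta>"
  \<comment> \<open>The sum 56 + 2 + 1: from \<open>ln (1 + \<theta>)\<close>, from
    \<open>ln (1 - w) + w\<close>, and from \<open>w - f * \<delta>\<close>.\<close>
  have "\<bar>x\<bar> \<le> 59 * \<beta>" unfolding x_def using lnw lnth w_up w_lo beta_bounds by linarith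
  moreover have "exp (real f * \<delta> + x) * ((1 - w) * (1 + \<theta>)) = 1"
  proof -
    have pos: "0 < 1 - w" "0 < 1 + \<theta>" using w_small th_half by auto
    have "exp (real f * \<delta> + x) = exp (- ln (1 - w)) * exp (- ln (1 + \<theta>))"
      unfolding x_def by (simp flip: exp_add)
    also have "\<dots> = inverse ((1 - w) * (1 + \<theta>))" using pos by (simp add: exp_minus)
    finally show ?thesis using pos by (simp only:) (intro left_inverse, auto)
  qed
  then have "A m (insert g F) = real (m - f) / N * exp (real f * \<delta> + x) * A m F"
  proof -
    assume e: "exp (real f * \<delta> + x) * ((1 - w) * (1 + \<theta>)) = 1"
    have "real (m - f) / N * exp (real f * \<delta> + x) * A m F
        = exp (real f * \<delta> + x) / N * (A0 * X)" unfolding X_eq by simp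
    also have "\<dots> = (exp (real f * \<delta> + x) * ((1 - w) * (1 + \<theta>))) * (A0 * (1 - b g))"
      unfolding X_theta G_eq using N_pos by simp
    also have "\<dots> = A m (insert g F)" unfolding e using ins[OF g] by simp
    finally show ?thesis by simp
  qed
  ultimately show ?thesis by blast
qed

text \<open>Removing any edge of \<open>F\<close> leaves a linear \<open>r\<close>-graph to which it
  is addable. The factors \<open>m - i\<close> multiply to the falling factorial, the exponents
  \<open>i * \<delta>\<close> sum to \<open>\<delta> * f * (f - 1) / 2\<close>, and the errors
  add.\<close>

lemma A_approx:
  assumes "F \<in> Lin r n f" "f \<le> m"
  shows "\<exists>x. \<bar>x\<bar> \<le> 59 * \<beta> * real f \<and>
    A m F = ffall (real m) f / N ^ f * exp (\<delta> * (real f * (real f - 1) / 2) + x) * A m {}"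
  using assms
proof (induction f arbitrary: F)
  case 0
  then have "F = {}" using LinD(3,4) by fastforce
  then show ?case by (intro exI[of _ 0]) (simp add: ffall_def)
next
  case (Suc f)
  note F = LinD[OF Suc.prems(1)]
  obtain g where g: "g \<in> F" using F(3) by fastforce
  define F' where "F' = F - {g}"
  have ins: "F = insert g F'" using g by (auto simp: F'_def)
  have F': "F' \<in> Lin r n f"
    using F g by (auto simp: F'_def Lin_iff linear_hg_def)
  have gF': "g \<in> addable r n F'"
    using F g unfolding F'_def addable_def linear_hg_def by auto
  obtain x where x: "\<bar>x\<bar> \<le> 59 * \<beta> * real f"
    "A m F' = ffall (real m) f / N ^ f * exp (\<delta> * (real f * (real f - 1) / 2) + x) * A m {}"
    using Suc.IH[OF F'] Suc.prems(2) by auto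
  obtain y where y: "\<bar>y\<bar> \<le> 59 * \<beta>"
    "A m F = real (m - f) / N * exp (real f * \<delta> + y) * A m F'"
    using A_insert_approx[OF F' gF'] Suc.prems(2) ins by auto
  have "\<bar>x + y\<bar> \<le> 59 * \<beta> * real (Suc f)"
    using x(1) y(1) abs_triangle_ineq[of x y] by (simp add: algebra_simps)
  moreover have "ffall (real m) (Suc f) = ffall (real m) f * real (m - f)"
    using Suc.prems(2) by (simp add: ffall_def of_nat_diff)
  moreover have "exp (\<delta> * (real (Suc f) * (real (Suc f) - 1) / 2) + (x + y))
      = exp (\<delta> * (real f * (real f - 1) / 2) + x) * exp (real f * \<delta> + y)"
    by (simp add: field_simps flip: exp_add)
  ultimately show ?case using x(2) y(2) by (intro exI[of _ "x + y"]) (simp add: mult_ac)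
qed

section \<open>Rewriting the exponent and the error in the stated form\<close>

lemma prob_contained_approx:
  assumes F: "F \<in> Lin r n k" and k: "k \<le> m"
  shows "\<exists>x. \<bar>x\<bar> \<le> 180 * (real r ^ 4 * real k / real n ^ 2
                 + min (real r ^ 6 * real m ^ 2 * real k / real n ^ 3)
                       (real r ^ 5 * real m * real k / real n ^ 2)) \<and>
    prob_contained r n m F = ffall (real m) k / real (n choose r) ^ k
      * exp (ffall (real r) 2 ^ 2 * real k ^ 2 / (4 * real n ^ 2) + x)"
proof -
  obtain x where x: "\<bar>x\<bar> \<le> 59 * \<beta> * real k"
    "A m F = ffall (real m) k / N ^ k * exp (\<delta> * (real k * (real k - 1) / 2) + x) * A m {}"
    using A_approx[OF F k] by blast
  have n0: "9 \<le> real n" using n9 by simp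
  have "{} \<in> Lin r n 0" by (simp add: Lin_iff linear_hg_def)
  then have "0 < A m {}"
    using mult_delta_le_eta[of m] eta_bounds by (intro A_pos) auto
  moreover have "prob_contained r n m F = A m F / A m {}"
    by (simp add: prob_contained_def extensions_def)
  ultimately have prob: "prob_contained r n m F
      = ffall (real m) k / N ^ k * exp (\<delta> * (real k * (real k - 1) / 2) + x)"
    using x(2) by simp
  \<comment> \<open>Collects the two corrections: \<open>n - 1\<close> becomes \<open>n\<close> in
    the denominator of \<delta>, and \<open>k * (k - 1)\<close> becomes \<open>k^2\<close>.\<close>
  define y where "y = real k * (real k * (\<delta> / real n)) / 2 - real k * \<delta> / 2"
  have ff: "ffall (real r) 2 ^ 2 * real k ^ 2 / (4 * real n ^ 2) = real k * real k * (\<delta> - \<delta> / real n) / 2"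
  proof -
    have "\<delta> - \<delta> / real n = \<delta> * (real n - 1) / real n" using n0 by (simp add: field_simps)
    also have "\<dots> = (real r * (real r - 1))\<^sup>2 / (2 * real n ^ 2)"
      unfolding \<delta>_def using n0 by (simp add: power2_eq_square)
    finally show ?thesis by (simp add: ffall_def numeral_2_eq_2 power2_eq_square)
  qed
  have exponent: "\<delta> * (real k * (real k - 1) / 2) = ffall (real r) 2 ^ 2 * real k ^ 2 / (4 * real n ^ 2) + y"
    unfolding ff y_def by (simp add: field_simps)
  \<comment> \<open>With \<open>k \<le> m\<close> this absorbs the first correction into
    \<open>\<beta> * k\<close>; both entries of the minimum \<beta> have to be checked.\<close>
  have md: "real m * (\<delta> / real n) \<le> \<beta>"
  proof -
    have "real m * (\<delta> / real n) \<le> real m * \<delta>"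
      using n0 delta_nonneg mult_right_mono[of 1 "real n" \<delta>]
      by (intro mult_left_mono) (auto simp: divide_le_eq mult.commute)
    moreover have "real m * (\<delta> / real n) \<le> real m ^ 2 * \<rho>"
    proof (intro mult_mono)
      have "\<delta> / real n \<le> real r ^ 4 / (2 * real n ^ 2) / real n"
        using delta_le by (intro divide_right_mono) auto
      also have "\<dots> = real r ^ 4 / (2 * real n ^ 3)" by (simp add: power2_eq_square power3_eq_cube mult_ac)
      also have "\<dots> \<le> (3 * real r ^ 6) / real n ^ 3"
      proof (intro frac_le)
        have "real r ^ 4 \<le> real r ^ 6" using r3 by (intro power_increasing) auto
        then show "real r ^ 4 \<le> 3 * real r ^ 6" using zero_le_power[of "real r" 6] by linarith
      qed (use n0 in auto)
      finally show "\<delta> / real n \<le> \<rho>" unfolding \<rho>_def .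
      show "real m \<le> real m ^ 2"
        using of_nat_mono[where 'a = real, OF le_square[of m]] by (simp add: power2_eq_square)
    qed (use delta_nonneg in auto)
    ultimately show ?thesis by (simp add: \<beta>_def \<eta>_def)
  qed
  have y: "\<bar>y\<bar> \<le> \<beta> * real k + real r ^ 4 * real k / real n ^ 2"
  proof -
    have "real k * (\<delta> / real n) \<le> real m * (\<delta> / real n)"
      using k delta_nonneg by (intro mult_right_mono) auto
    then have "real k * (real k * (\<delta> / real n)) \<le> real k * \<beta>"
      using md by (intro mult_left_mono) auto
    moreover have "0 \<le> real k * (real k * (\<delta> / real n))" using delta_nonneg by simp
    moreover have "real k * \<delta> \<le> real k * (real r ^ 4 / (2 * real n ^ 2))"
      using delta_le by (intro mult_left_mono) auto
    moreover have "0 \<le> real k * \<delta>" using delta_nonneg by simp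
    moreover have "real k * (real r ^ 4 / (2 * real n ^ 2)) = real r ^ 4 * real k / real n ^ 2 / 2"
      by (simp add: mult.commute)
    moreover have "0 \<le> real r ^ 4 * real k / real n ^ 2" by simp
    moreover have "\<bar>u / 2 - v / 2\<bar> \<le> b + Z"
      if "u \<le> b" "0 \<le> u" "v \<le> z" "0 \<le> v" "z = Z / 2" "0 \<le> Z" for u v b z Z :: real
      using that by linarith
    ultimately show ?thesis unfolding y_def mult.commute[of \<beta>] by blast
  qed
  define X4 X5 X6 where X: "X4 = real r ^ 4 * real k / real n ^ 2"
    "X5 = real r ^ 5 * real m * real k / real n ^ 2" "X6 = real r ^ 6 * real m ^ 2 * real k / real n ^ 3"
  have X0: "0 \<le> X4" "0 \<le> X5" unfolding X by simp_all
  have "\<beta> * real k \<le> (real m ^ 2 * \<rho>) * real k" using beta_bounds by (intro mult_right_mono) auto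
  also have "\<dots> = 3 * X6" unfolding \<rho>_def X by simp
  finally have le_X6: "\<beta> * real k \<le> 3 * X6" .
  have "\<beta> * real k \<le> (real m * \<delta>) * real k"
    using beta_bounds unfolding \<eta>_def by (intro mult_right_mono) auto
  \<comment> \<open>The bound of order \<open>r^4\<close> from \<open>delta_le\<close> is enlarged
    to the \<open>r^5\<close> of the statement.\<close>
  also have "\<dots> \<le> (real m * (real r ^ 5 / real n ^ 2)) * real k"
  proof (intro mult_right_mono mult_left_mono)
    have "\<delta> \<le> real r ^ 4 / (2 * real n ^ 2)" by (rule delta_le)
    also have "\<dots> \<le> real r ^ 5 / real n ^ 2"
      using r3 n0 by (intro frac_le power_increasing) auto
    finally show "\<delta> \<le> real r ^ 5 / real n ^ 2" .
  qed auto
  also have "\<dots> = X5" unfolding X by simp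
  finally have "\<beta> * real k \<le> X5" .
  then have "\<beta> * real k \<le> 3 * min X6 X5" using le_X6 X0 by (simp add: min_def)
  moreover have "\<bar>y\<bar> \<le> \<beta> * real k + X4" using y unfolding X .
  moreover have "\<bar>x\<bar> \<le> 59 * (\<beta> * real k)" using x(1) by (simp only: mult.assoc)
  \<comment> \<open>The part of the error in \<beta> has factor 59 + 1 = 60, and
    \<open>\<beta> * k\<close> is at most three times the minimum, so 180 results.\<close>
  moreover have "\<bar>y + x\<bar> \<le> 180 * (X4 + t)"
    if "z \<le> 3 * t" "\<bar>y\<bar> \<le> z + X4" "\<bar>x\<bar> \<le> 59 * z" for z t :: real
    using that X0(1) unfolding abs_le_iff distrib_left by linarith
  ultimately have "\<bar>y + x\<bar> \<le> 180 * (X4 + min X6 X5)" by blast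
  then show ?thesis using prob unfolding exponent N_def X by (intro exI[of _ "y + x"]) (simp add: add.assoc)
qed

end

section \<open>From fixed parameters to the asymptotic statement\<close>

text \<open>With \<open>s = sqrt n\<close> the hypothesis reads
  \<open>56 * m * r^3 \<le> s^3\<close>. Since \<open>1 \<le> m\<close>, this forces
  \<open>r \<le> s\<close>, that is \<open>r^2 \<le> n\<close>; and
  \<open>m * \<delta> \<le> m * r^4 / (2 * n^2)\<close> is then at most 1/112.\<close>

lemma sparse_range_edges_if_small:
  assumes r: "3 \<le> r" and m: "1 \<le> m"
    and small: "real m \<le> 1/56 * (real n powr (3/2) / real r ^ 3)"
  shows "sparse_range_edges n r m"
proof -
  define s where "s = sqrt (real n)"
  have s0: "0 \<le> s" and s2: "s\<^sup>2 = real n" by (simp_all add: s_def)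
  have s3: "real n powr (3/2) = s ^ 3"
  proof (cases "n = 0")
    case False
    then have "real n powr (3/2) = (real n powr (1/2)) powr 3" by (simp add: powr_powr)
    also have "\<dots> = s ^ 3" using False by (simp add: s_def powr_half_sqrt flip: powr_numeral)
    finally show ?thesis .
  qed (simp add: s_def)
  have r0: "0 < real r" using r by simp
  have mr: "56 * real m * real r ^ 3 \<le> s ^ 3"
    using small r0 unfolding s3 by (simp add: field_simps)
  have "real r ^ 3 \<le> 56 * real m * real r ^ 3"
    using m by (intro mult_right_mono[of 1 "56 * real m", simplified]) auto
  then have rs: "real r \<le> s"
    using mr s0 by (intro power_le_imp_le_base[of "real r" 2 s]) (simp_all add: numeral_3_eq_3)
  then have "real r ^ 2 \<le> real n" using s2 power_mono[OF rs, of 2] by simp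
  then have rn: "r\<^sup>2 \<le> n" by (metis of_nat_le_iff of_nat_power)
  interpret sparse_range n r by unfold_locales (use r rn in auto)
  have spos: "0 < s" using rs r0 by linarith
  have "real m * \<delta> \<le> real m * (real r ^ 4 / (2 * real n ^ 2))"
    using delta_le by (intro mult_left_mono) auto
  also have "\<dots> = (56 * real m * real r ^ 3) * real r / (112 * s ^ 4)"
    by (simp add: power4_eq_xxxx power3_eq_cube power2_eq_square flip: s2)
  also have "\<dots> \<le> s ^ 3 * s / (112 * s ^ 4)"
    using mr rs spos by (intro divide_right_mono mult_mono) auto
  also have "\<dots> = 1/112" using spos by (simp add: power4_eq_xxxx power3_eq_cube)
  finally show ?thesis by unfold_locales simp
qed

theorem theorem1p5:
  fixes r m k :: "nat \<Rightarrow> nat" and K :: "nat \<Rightarrow> nat set set"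
  assumes r3: "\<forall>\<^sub>F n in sequentially. r n \<ge> 3"
    and m_small: "(\<lambda>n. real (m n)) \<in> o(\<lambda>n. real n powr (3/2) / real (r n) ^ 3)"
    and k_small: "(\<lambda>n. real (k n) * real (r n) ^ 6 * real (m n) ^ 2) \<in> o(\<lambda>n. real n ^ 3)"
    and K: "\<forall>\<^sub>F n in sequentially. K n \<in> Lin (r n) n (k n)"
  shows "\<exists>E :: nat \<Rightarrow> real.
           E \<in> O(\<lambda>n. real (r n) ^ 4 * real (k n) / real n ^ 2
                 + min (real (r n) ^ 6 * real (m n) ^ 2 * real (k n) / real n ^ 3)
                       (real (r n) ^ 5 * real (m n) * real (k n) / real n ^ 2)) \<and>
           (\<forall>\<^sub>F n in sequentially.
              prob_contained (r n) n (m n) (K n) =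
                ffall (real (m n)) (k n) / real (n choose r n) ^ k n
                * exp (ffall (real (r n)) 2 ^ 2 * real (k n) ^ 2 / (4 * real n ^ 2) + E n))"
proof -
  let ?g = "\<lambda>n. real (r n) ^ 4 * real (k n) / real n ^ 2
                 + min (real (r n) ^ 6 * real (m n) ^ 2 * real (k n) / real n ^ 3)
                       (real (r n) ^ 5 * real (m n) * real (k n) / real n ^ 2)"
  let ?P = "\<lambda>n x. prob_contained (r n) n (m n) (K n) =
                ffall (real (m n)) (k n) / real (n choose r n) ^ k n
                * exp (ffall (real (r n)) 2 ^ 2 * real (k n) ^ 2 / (4 * real n ^ 2) + x)"
  have g0: "0 \<le> ?g n" for n by simp
  have "\<forall>\<^sub>F n in sequentially. real (m n) \<le> 1/56 * (real n powr (3/2) / real (r n) ^ 3)"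
    using landau_o.smallD[OF m_small, of "1/56"] by simp
  \<comment> \<open>A constant that is uniform in \<open>n\<close> is proved pointwise first; the
    error function is chosen from these witnesses afterwards.\<close>
  with r3 K have "\<forall>\<^sub>F n in sequentially. \<exists>x. \<bar>x\<bar> \<le> 180 * ?g n \<and> ?P n x"
  proof eventually_elim
    case (elim n)
    note F = LinD[OF elim(2)]
    consider "m n < k n" | "m n = 0" "k n = 0" | "1 \<le> m n" "k n \<le> m n" by linarith
    then show ?case
    proof cases
      \<comment> \<open>Both sides vanish: \<open>K n\<close> has too many edges to be contained,
        and the falling factorial has a zero factor.\<close>
      case 1
      have "extensions (r n) n (m n) (K n) = {}"
        using F(3,4) 1 by (intro extensions_empty_if_card_gt) auto
      then have "prob_contained (r n) n (m n) (K n) = 0"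
        unfolding prob_contained_def extensions_def by (simp only: card.empty)
      moreover have "ffall (real (m n)) (k n) = 0"
        unfolding ffall_def using 1 by (intro prod_zero) auto
      ultimately show ?thesis using g0[of n] by (intro exI[of _ 0]) simp
    next
      case 2
      then have K0: "K n = {}" using F(3,4) by simp
      have "{} \<in> Lin (r n) n 0" by (simp add: Lin_iff linear_hg_def)
      then have "card (Lin (r n) n 0) \<noteq> 0" using finite_Lin[of "r n" n 0] by auto
      then show ?thesis using 2 K0 by (intro exI[of _ 0]) (simp add: prob_contained_def ffall_def)
    next
      case 3
      interpret sparse_range_edges n "r n" "m n"
        using elim 3 by (intro sparse_range_edges_if_small) auto
      show ?thesis by (rule prob_contained_approx[OF elim(2) 3(2)])
    qed
  qed
  then obtain E where E: "\<forall>\<^sub>F n in sequentially. \<bar>E n\<bar> \<le> 180 * ?g n \<and> ?P n (E n)"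
    unfolding eventually_ex by blast
  have "E \<in> O(?g)"
  proof (rule bigoI[where c = 180])
    show "\<forall>\<^sub>F n in sequentially. norm (E n) \<le> 180 * norm (?g n)"
      using E by eventually_elim (use g0 in \<open>simp del: of_nat_power\<close>)
  qed
  moreover have "\<forall>\<^sub>F n in sequentially. ?P n (E n)" using E by eventually_elim simp
  ultimately show ?thesis by blast
qed

end
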